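(* Let $R>0$ and let $\Phi$ be real-analytic on $(-R,R)$ with expansion $\Phi(z)=\sum_{n\ge0}c_nz^n$. Let $u$ be analytic with radius of convergence $\Lambda$, and let $0<\lambda<\Lambda$ satisfy $\|u\|_\lambda<R$. Then the series $\Phi(u):=\sum_{n\ge0}c_nu^n$ converges in $\|\cdot\|_\lambda$. Moreover, $$\|\Phi(u)\|_\lambda\le\tilde\Phi(\|u\|_\lambda)\qquad\text{and}\qquad |\Phi(u)|_{\lambda,1}\le\tilde\Phi'(\|u\|_\lambda)\,|u|_{\lambda,1}.$$
   Context: A function $f:\mathbb{R}^2\to\mathbb{R}$, $f=f(x,v)$, is analytic with radius of convergence $\Lambda>0$ if it is smooth and there is $C>0$ with $\frac{\Lambda^{k+\ell}}{k!\,\ell!}\|\partial_x^k\partial_v^\ell f\|_\infty\le C$ for all $k,\ell\in\mathbb{N}_0$ ($\|\cdot\|_\infty$ is the supremum norm). For functions of $x$ only (resp. $v$ only) take $\ell=0$ (resp. $k=0$). For $\lambda>0$, $n\in\mathbb{N}_0$, $$\|f\|_\lambda=\sum_{k,\ell\ge0}\frac{\lambda^{k+\ell}}{k!\,\ell!}\|\partial_x^k\partial_v^\ell f\|_\infty,\qquad |f|_{\lambda,n}=\frac{d^n}{d\lambda^n}\|f\|_\lambda=\sum_{k+\ell\ge n}\frac{(k+\ell)!}{(k+\ell-n)!}\frac{\lambda^{k+\ell-n}}{k!\,\ell!}\|\partial_x^k\partial_v^\ell f\|_\infty .$$ $\Phi:\mathbb{R}\to\mathbb{R}$ is real-analytic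 on $(-R,R)$ if $\Phi(z)=\sum_{n\ge0}c_nz^n$ for all $|z|<R$, with real $c_n$; for $0\le r<R$ its majorants are $\tilde\Phi(r)=\sum_{n\ge0}|c_n|r^n$ and $\tilde\Phi'(r)=\sum_{n\ge1}n|c_n|r^{n-1}$. *)

theory Defs
  imports "HOL-Analysis.Analysis"
begin

definition partial_x :: "(real \<times> real \<Rightarrow> real) \<Rightarrow> real \<times> real \<Rightarrow> real" where
  "partial_x f = (\<lambda>(x, v). deriv (\<lambda>s. f (s, v)) x)"

definition partial_v :: "(real \<times> real \<Rightarrow> real) \<Rightarrow> real \<times> real \<Rightarrow> real" where
  "partial_v f = (\<lambda>(x, v). deriv (\<lambda>s. f (x, s)) v)"

definition mixed_partial :: "nat \<Rightarrow> nat \<Rightarrow> (real \<times> real \<Rightarrow> real) \<Rightarrow> real \<times> real \<Rightarrow> real" where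
  "mixed_partial k l f = (partial_x ^^ k) ((partial_v ^^ l) f)"

primrec C_k :: "nat \<Rightarrow> (real \<times> real \<Rightarrow> real) \<Rightarrow> bool" where
  "C_k 0 f \<longleftrightarrow> continuous_on UNIV f"
| "C_k (Suc m) f \<longleftrightarrow> f differentiable_on UNIV \<and> C_k m (partial_x f) \<and> C_k m (partial_v f)"

definition smooth :: "(real \<times> real \<Rightarrow> real) \<Rightarrow> bool" where
  "smooth f \<longleftrightarrow> (\<forall>m. C_k m f)"

text \<open>All norms take values in \<^typ>\<open>ennreal\<close>, so that an unbounded function or a divergent
  series has norm \<open>\<infinity>\<close> instead of an arbitrary real value.\<close>

definition sup_norm :: "(real \<times> real \<Rightarrow> real) \<Rightarrow> ennreal" where
  "sup_norm f = (SUP z. ennreal \<bar>f z\<bar>)"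

definition analytic_radius :: "real \<Rightarrow> (real \<times> real \<Rightarrow> real) \<Rightarrow> bool" where
  "analytic_radius \<Lambda> f \<longleftrightarrow> \<Lambda> > 0 \<and> smooth f \<and>
     (\<exists>C>0. \<forall>k l. ennreal (\<Lambda> ^ (k + l) / (fact k * fact l)) * sup_norm (mixed_partial k l f)
                    \<le> ennreal C)"

definition lam_norm :: "real \<Rightarrow> (real \<times> real \<Rightarrow> real) \<Rightarrow> ennreal" where
  "lam_norm lam f =
     (\<Sum>k. \<Sum>l. ennreal (lam ^ (k + l) / (fact k * fact l)) * sup_norm (mixed_partial k l f))"

text \<open>The \<open>n\<close>-th derivative of \<open>lam \<mapsto> lam_norm lam f\<close>, given by its termwise differentiated series.\<close>

definition lam_seminorm :: "real \<Rightarrow> nat \<Rightarrow> (real \<times> real \<Rightarrow> real) \<Rightarrow> ennreal" where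
  "lam_seminorm lam n f =
     (\<Sum>k. \<Sum>l. if n \<le> k + l
        then ennreal (fact (k + l) / fact (k + l - n) * (lam ^ (k + l - n) / (fact k * fact l)))
               * sup_norm (mixed_partial k l f)
        else 0)"

definition lam_space :: "real \<Rightarrow> (real \<times> real \<Rightarrow> real) set" where
  "lam_space lam = {f. smooth f \<and> lam_norm lam f < \<infinity>}"

definition lam_sums ::
  "real \<Rightarrow> (nat \<Rightarrow> real \<times> real \<Rightarrow> real) \<Rightarrow> (real \<times> real \<Rightarrow> real) \<Rightarrow> bool" where
  "lam_sums lam f g \<longleftrightarrow> (\<forall>n. f n \<in> lam_space lam) \<and> g \<in> lam_space lam \<and>
     (\<lambda>N. lam_norm lam (\<lambda>z. (\<Sum>n<N. f n z) - g z)) \<longlonglongrightarrow> 0"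

definition majorant :: "(nat \<Rightarrow> real) \<Rightarrow> real \<Rightarrow> real" where
  "majorant c r = (\<Sum>n. \<bar>c n\<bar> * r ^ n)"

text \<open>Here the index is shifted: the \<open>n\<close>-th summand is the term of degree \<open>n\<close> in \<open>r\<close>, which comes
  from \<open>c (n + 1)\<close>.\<close>

definition majorant_deriv :: "(nat \<Rightarrow> real) \<Rightarrow> real \<Rightarrow> real" where
  "majorant_deriv c r = (\<Sum>n. real (Suc n) * \<bar>c (Suc n)\<bar> * r ^ n)"

end

(* Leibniz' rule makes the Taylor weights lam^(k+l)/(k! l!) ||d_x^k d_v^l f|| submultiplicative under
   double convolution. Summing them gives ||f g|| <= ||f|| ||g||, and summing them against k + l,
   which is additive along the convolution and yields lam * |f|_{lam,1}, gives the product rule for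
   the seminorm. Hence ||u^n|| <= ||u||^n and |u^n|_1 <= n ||u||^(n-1) |u|_1. These bounds also
   justify differentiating the series termwise, and convergence in norm is the norm estimate
   applied to the tail of the series. *)
theory Submission
  imports Defs
begin

section \<open>Partial derivatives as derivatives along a line\<close>

lemma C_k_Suc_imp: "C_k (Suc m) f \<Longrightarrow> C_k m f"
proof (induction m arbitrary: f)
  case 0
  then show ?case by (simp add: differentiable_imp_continuous_on)
next
  case (Suc m)
  then show ?case by (metis C_k.simps(2))
qed

lemma partial_x_eq: "partial_x f z = deriv (\<lambda>t. f (z + t *\<^sub>R (1, 0))) 0"
  by (cases z) (simp add: partial_x_def, subst deriv_shift_0, simp add: o_def)

lemma partial_v_eq: "partial_v f z = deriv (\<lambda>t. f (z + t *\<^sub>R (0, 1))) 0"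
  by (cases z) (simp add: partial_v_def, subst deriv_shift_0, simp add: o_def)

lemma smooth_imp_differentiable_on: "smooth f \<Longrightarrow> f differentiable_on UNIV"
  unfolding smooth_def by (metis C_k.simps(2))

lemma smooth_partial_x: "smooth f \<Longrightarrow> smooth (partial_x f)"
  unfolding smooth_def by (metis C_k.simps(2))

lemma smooth_partial_v: "smooth f \<Longrightarrow> smooth (partial_v f)"
  unfolding smooth_def by (metis C_k.simps(2))

text \<open>Both partial derivatives differentiate along a fixed direction \<open>e\<close> at
  parameter 0, so the calculus is developed once for \<open>D\<close> and interpreted twice.\<close>

locale coordinate_derivative =
  fixes D :: "(real \<times> real \<Rightarrow> real) \<Rightarrow> real \<times> real \<Rightarrow> real" and e :: "real \<times> real"
  assumes D_eq: "D f z = deriv (\<lambda>t. f (z + t *\<^sub>R e)) 0"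
    and smooth_D: "smooth f \<Longrightarrow> smooth (D f)"
begin

text \<open>Total differentiability and the chain rule give a derivative at parameter 0. Since
  \<open>D_eq\<close> speaks only of parameter 0, other values of \<open>t\<close> are reached by
  moving the base point to \<open>z + t *\<^sub>R e\<close> and shifting back.\<close>

lemma DERIV_line:
  assumes "f differentiable_on UNIV"
  shows "((\<lambda>t. f (z + t *\<^sub>R e)) has_real_derivative D f (z + t *\<^sub>R e)) (at t)"
proof -
  have "((\<lambda>s. f ((z + t *\<^sub>R e) + s *\<^sub>R e)) has_real_derivative D f (z + t *\<^sub>R e)) (at 0)"
  proof -
    obtain f' where f': "(f has_derivative f') (at (z + t *\<^sub>R e))"
      using assms unfolding differentiable_on_def differentiable_def by blast
    have "((\<lambda>s. f ((z + t *\<^sub>R e) + s *\<^sub>R e)) has_derivative (\<lambda>s. f' (s *\<^sub>R e))) (at 0)"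
      by (rule has_derivative_compose[where g = f]) (auto intro!: derivative_eq_intros f')
    then have "(\<lambda>s. f ((z + t *\<^sub>R e) + s *\<^sub>R e)) differentiable (at 0)"
      by (auto simp: differentiable_def)
    then show ?thesis
      by (simp add: D_eq DERIV_deriv_iff_real_differentiable)
  qed
  then show ?thesis
    by (subst DERIV_shift[of _ _ 0 t, simplified]) (simp add: algebra_simps)
qed

lemma D_eqI:
  assumes "((\<lambda>t. f (z + t *\<^sub>R e)) has_real_derivative d) (at 0)"
  shows "D f z = d"
  using assms by (simp add: D_eq DERIV_imp_deriv)

lemma DERIV_line_0:
  "f differentiable_on UNIV \<Longrightarrow> ((\<lambda>t. f (z + t *\<^sub>R e)) has_real_derivative D f z) (at 0)"
  using DERIV_line[of f z 0] by simp

lemma D_add: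
  assumes "f differentiable_on UNIV" "g differentiable_on UNIV"
  shows "D (\<lambda>z. f z + g z) = (\<lambda>z. D f z + D g z)"
  using assms by (intro ext D_eqI DERIV_add DERIV_line_0)

lemma D_cmult:
  assumes "f differentiable_on UNIV"
  shows "D (\<lambda>z. a * f z) = (\<lambda>z. a * D f z)"
  using assms by (intro ext D_eqI DERIV_cmult DERIV_line_0)

lemma D_const: "D (\<lambda>z. a) = (\<lambda>z. 0)"
  by (intro ext D_eqI) simp

lemma D_mult:
  assumes "f differentiable_on UNIV" "g differentiable_on UNIV"
  shows "D (\<lambda>z. f z * g z) = (\<lambda>z. D f z * g z + f z * D g z)"
proof (intro ext D_eqI)
  fix z
  show "((\<lambda>t. f (z + t *\<^sub>R e) * g (z + t *\<^sub>R e)) has_real_derivative D f z * g z + f z * D g z) (at 0)"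
    using DERIV_mult[OF DERIV_line_0[OF assms(1), of z] DERIV_line_0[OF assms(2), of z]]
    by (simp add: algebra_simps)
qed

lemma D_compose:
  assumes "f differentiable_on UNIV" "\<And>z. (\<phi> has_real_derivative \<phi>' (f z)) (at (f z))"
  shows "D (\<lambda>z. \<phi> (f z)) = (\<lambda>z. \<phi>' (f z) * D f z)"
proof (intro ext D_eqI)
  fix z
  show "((\<lambda>t. \<phi> (f (z + t *\<^sub>R e))) has_real_derivative \<phi>' (f z) * D f z) (at 0)"
    using DERIV_chain2[OF _ DERIV_line_0[OF assms(1), of z], of \<phi> "\<phi>' (f z)"] assms(2)[of z] by simp
qed

lemma smooth_D_funpow: "smooth f \<Longrightarrow> smooth ((D ^^ k) f)"
  by (induction k) (auto intro: smooth_D)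

end

interpretation x: coordinate_derivative partial_x "(1, 0)"
  by standard (rule partial_x_eq, rule smooth_partial_x)

interpretation v: coordinate_derivative partial_v "(0, 1)"
  by standard (rule partial_v_eq, rule smooth_partial_v)

section \<open>Closure properties of smooth functions\<close>

lemma C_k_const: "C_k m (\<lambda>z. a)"
  by (induction m arbitrary: a) (auto simp: x.D_const v.D_const)

lemma C_k_add: "C_k m f \<Longrightarrow> C_k m g \<Longrightarrow> C_k m (\<lambda>z. f z + g z)"
  by (induction m arbitrary: f g)
     (auto simp: x.D_add v.D_add intro: continuous_on_add differentiable_on_add)

lemma C_k_mult: "C_k m f \<Longrightarrow> C_k m g \<Longrightarrow> C_k m (\<lambda>z. f z * g z)"
proof (induction m arbitrary: f g)
  case 0
  then show ?case by (auto intro: continuous_on_mult)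
next
  case (Suc m)
  \<comment> \<open>The product rule leaves one factor undifferentiated, so the induction hypothesis
    needs \<open>f\<close> and \<open>g\<close> themselves at order \<open>m\<close>.\<close>
  have "C_k m f" "C_k m g"
    using Suc.prems[THEN C_k_Suc_imp] .
  with Suc show ?case
    by (auto simp: x.D_mult v.D_mult intro!: C_k_add differentiable_on_mult)
qed

text \<open>By the chain rule the partial derivatives of a composition are again products with
  compositions, now for the series with coefficients \<open>diffs c\<close>; so smoothness needs neither termwise
  differentiation nor the symmetry of mixed partial derivatives.\<close>

lemma C_k_power_series_compose:
  assumes "\<And>z. norm z < R \<Longrightarrow> summable (\<lambda>n. c n * z ^ n)"
    and "\<And>z. \<bar>f z\<bar> < R" and "C_k m f"
  shows "C_k m (\<lambda>z. \<Sum>n. c n * (f z :: real) ^ n)"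
  using assms(1,3)
proof (induction m arbitrary: c)
  case 0
  have "isCont (\<lambda>y. \<Sum>n. c n * y ^ n) y" if "\<bar>y\<bar> < R" for y
    using termdiffs_strong'[of R c y] 0 that by (auto intro: DERIV_isCont)
  then have "continuous_on {-R<..<R} (\<lambda>y. \<Sum>n. c n * y ^ n)"
    by (auto intro!: continuous_at_imp_continuous_on)
  from continuous_on_compose2[OF this, of UNIV f] show ?case
    using 0 assms(2) by (force simp: abs_less_iff)
next
  case (Suc m)
  let ?\<phi> = "\<lambda>c y. \<Sum>n. c n * y ^ n :: real"
  have deriv: "(?\<phi> c has_real_derivative ?\<phi> (diffs c) (f z)) (at (f z))" for z
    using termdiffs_strong'[of R c "f z"] Suc.prems(1) assms(2) by auto
  have "summable (\<lambda>n. diffs c n * z ^ n)" if "norm z < R" for z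
    using termdiff_converges[OF that Suc.prems(1)] .
  then have comp: "C_k m (\<lambda>z. ?\<phi> (diffs c) (f z))"
    by (rule Suc.IH[OF _ C_k_Suc_imp[OF Suc.prems(2)]])
  have diff: "f differentiable_on UNIV"
    using Suc.prems(2) by simp
  have "(\<lambda>z. ?\<phi> c (f z)) differentiable_on UNIV"
    unfolding differentiable_on_def
  proof
    fix z
    obtain f' where "(f has_derivative f') (at z)"
      using diff unfolding differentiable_on_def differentiable_def by blast
    from has_derivative_compose[OF this deriv[of z, unfolded has_field_derivative_def]]
    show "(\<lambda>z. ?\<phi> c (f z)) differentiable at z within UNIV"
      by (auto simp: differentiable_def)
  qed
  then show ?case
    using x.D_compose[OF diff, of "?\<phi> c", OF deriv] v.D_compose[OF diff, of "?\<phi> c", OF deriv]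
      comp Suc.prems(2) by (auto intro: C_k_mult)
qed

lemma smooth_const: "smooth (\<lambda>z. a)"
  and smooth_add: "smooth f \<Longrightarrow> smooth g \<Longrightarrow> smooth (\<lambda>z. f z + g z)"
  and smooth_mult: "smooth f \<Longrightarrow> smooth g \<Longrightarrow> smooth (\<lambda>z. f z * g z)"
  unfolding smooth_def by (auto intro: C_k_const C_k_add C_k_mult)

lemma smooth_sum: "(\<And>i. i \<in> I \<Longrightarrow> smooth (f i)) \<Longrightarrow> smooth (\<lambda>z. \<Sum>i\<in>I. f i z)"
  by (induction I rule: infinite_finite_induct) (auto intro: smooth_const smooth_add)

lemma smooth_power: "smooth f \<Longrightarrow> smooth (\<lambda>z. f z ^ n)"
  by (induction n) (auto intro: smooth_const smooth_mult)

lemma smooth_power_series_compose: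
  assumes "\<And>z. norm z < R \<Longrightarrow> summable (\<lambda>n. c n * z ^ n)"
    and "\<And>z. \<bar>f z\<bar> < R" and "smooth f"
  shows "smooth (\<lambda>z. \<Sum>n. c n * (f z :: real) ^ n)"
  using C_k_power_series_compose[of R c f] assms unfolding smooth_def by blast

section \<open>Iterated derivatives of sums, products and series\<close>

context coordinate_derivative
begin

lemma funpow_D_add:
  assumes "smooth f" "smooth g"
  shows "(D ^^ k) (\<lambda>z. f z + g z) = (\<lambda>z. (D ^^ k) f z + (D ^^ k) g z)"
  using assms
  by (induction k) (auto simp: D_add smooth_D_funpow smooth_imp_differentiable_on)

lemma funpow_D_cmult:
  assumes "smooth f"
  shows "(D ^^ k) (\<lambda>z. a * f z) = (\<lambda>z. a * (D ^^ k) f z)"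
  using assms
  by (induction k) (auto simp: D_cmult smooth_D_funpow smooth_imp_differentiable_on)

lemma funpow_D_const: "(D ^^ k) (\<lambda>z. a) = (\<lambda>z. if k = 0 then a else 0)"
  by (induction k) (auto simp: D_const)

lemma funpow_D_sum:
  assumes "\<And>i. i \<in> I \<Longrightarrow> smooth (f i)"
  shows "(D ^^ k) (\<lambda>z. \<Sum>i\<in>I. f i z) = (\<lambda>z. \<Sum>i\<in>I. (D ^^ k) (f i) z)"
  using assms
  by (induction I rule: infinite_finite_induct)
     (auto simp: funpow_D_const funpow_D_add smooth_sum fun_eq_iff)

lemma funpow_D_mult:
  assumes "smooth f" "smooth g"
  shows "(D ^^ k) (\<lambda>z. f z * g z) =
    (\<lambda>z. \<Sum>i\<le>k. real (k choose i) * ((D ^^ i) f z * (D ^^ (k - i)) g z))"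
  using assms
proof (induction k arbitrary: f g)
  case 0
  then show ?case by simp
next
  case (Suc k)
  note sm = Suc.prems Suc.prems[THEN smooth_D]
  \<comment> \<open>The innermost derivative is split off, so that the induction hypothesis applies
    to the pairs \<open>D f, g\<close> and \<open>f, D g\<close>; hence the induction over arbitrary
    factors.\<close>
  have "(D ^^ Suc k) (\<lambda>z. f z * g z) = (D ^^ k) (\<lambda>z. D f z * g z + f z * D g z)"
    using sm by (simp add: funpow_swap1 D_mult smooth_imp_differentiable_on)
  also have "\<dots> = (\<lambda>z. (D ^^ k) (\<lambda>z. D f z * g z) z + (D ^^ k) (\<lambda>z. f z * D g z) z)"
    using sm by (intro funpow_D_add smooth_mult)
  also have "\<dots> = (\<lambda>z. (\<Sum>i\<le>k. real (k choose i) * ((D ^^ Suc i) f z * (D ^^ (k - i)) g z)) +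
      (\<Sum>i\<le>k. real (k choose i) * ((D ^^ i) f z * (D ^^ Suc (k - i)) g z)))"
    using sm by (simp add: Suc.IH funpow_swap1 del: funpow.simps(2)) (simp add: funpow_swap1)
  also have "\<dots> = (\<lambda>z. \<Sum>i\<le>Suc k. real (Suc k choose i) * ((D ^^ i) f z * (D ^^ (Suc k - i)) g z))"
  proof
    fix z
    define h where "h i j = (D ^^ i) f z * (D ^^ j) g z" for i j
    \<comment> \<open>The added summand \<open>i = Suc k\<close> vanishes because
      \<open>k choose Suc k\<close> is 0.\<close>
    have "(\<Sum>i\<le>k. real (k choose i) * h i (Suc (k - i))) =
        (\<Sum>i\<le>Suc k. real (k choose i) * h i (Suc k - i))"
      by (simp add: Suc_diff_le)
    also have "\<dots> = h 0 (Suc k) + (\<Sum>i\<le>k. real (k choose Suc i) * h (Suc i) (k - i))"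
      by (subst sum.atMost_Suc_shift) simp
    \<comment> \<open>Pascal's rule merges the two coefficients of
      \<open>h (Suc i) (k - i)\<close>.\<close>
    finally have "(\<Sum>i\<le>k. real (k choose i) * h (Suc i) (k - i)) +
        (\<Sum>i\<le>k. real (k choose i) * h i (Suc (k - i))) =
        h 0 (Suc k) + (\<Sum>i\<le>k. real (Suc k choose Suc i) * h (Suc i) (k - i))"
      by (simp add: sum.distrib algebra_simps)
    also have "\<dots> = (\<Sum>i\<le>Suc k. real (Suc k choose i) * h i (Suc k - i))"
      by (subst sum.atMost_Suc_shift) simp
    finally show "(\<Sum>i\<le>k. real (k choose i) * ((D ^^ Suc i) f z * (D ^^ (k - i)) g z)) +
      (\<Sum>i\<le>k. real (k choose i) * ((D ^^ i) f z * (D ^^ Suc (k - i)) g z)) =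
      (\<Sum>i\<le>Suc k. real (Suc k choose i) * ((D ^^ i) f z * (D ^^ (Suc k - i)) g z))"
      unfolding h_def .
  qed
  finally show ?case .
qed

text \<open>The bounds \<open>M k\<close> are uniform in \<open>z\<close>. In the step from
  \<open>k\<close> to \<open>Suc k\<close>, \<open>M (Suc k)\<close> gives uniform convergence of
  the differentiated series by the Weierstrass test, and \<open>M k\<close> gives convergence at one
  point of the line.\<close>

lemma funpow_D_suminf:
  assumes "\<And>n. smooth (f n)" and "\<And>k. summable (M k)"
    and "\<And>k n z. \<bar>(D ^^ k) (f n) z\<bar> \<le> M k n"
  shows "(D ^^ k) (\<lambda>z. \<Sum>n. f n z) = (\<lambda>z. \<Sum>n. (D ^^ k) (f n) z)"
proof (induction k)
  case (Suc k)
  have "D (\<lambda>z. \<Sum>n. (D ^^ k) (f n) z) z = (\<Sum>n. (D ^^ Suc k) (f n) z)" for z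
  proof (rule D_eqI)
    let ?g = "\<lambda>n t. (D ^^ k) (f n) (z + t *\<^sub>R e)"
    let ?g' = "\<lambda>n t. (D ^^ Suc k) (f n) (z + t *\<^sub>R e)"
    have "((\<lambda>t. \<Sum>n. ?g n t) has_real_derivative (\<Sum>n. ?g' n 0)) (at 0)"
    proof (rule has_field_derivative_series'(2)[of UNIV ?g ?g' 0])
      show "(?g n has_real_derivative ?g' n t) (at t within UNIV)" for n t
        using DERIV_line[OF smooth_imp_differentiable_on[OF smooth_D_funpow[OF assms(1)]]] by simp
      show "uniformly_convergent_on UNIV (\<lambda>n t. \<Sum>i<n. ?g' i t)"
        by (rule Weierstrass_m_test'[where M = "M (Suc k)"]) (simp_all only: real_norm_def assms)
      show "summable (\<lambda>n. ?g n 0)"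
        by (rule summable_comparison_test'[where g = "M k" and N = 0]) (simp_all only: real_norm_def assms)
    qed auto
    then show "((\<lambda>t. \<Sum>n. ?g n t) has_real_derivative (\<Sum>n. (D ^^ Suc k) (f n) z)) (at 0)"
      by simp
  qed
  with Suc show ?case by auto
qed simp

end

section \<open>Mixed partial derivatives\<close>

lemma mixed_partial_const: "mixed_partial k l (\<lambda>z. a) = (\<lambda>z. if k = 0 \<and> l = 0 then a else 0)"
  by (auto simp: mixed_partial_def v.funpow_D_const x.funpow_D_const)

lemma mixed_partial_cmult:
  "smooth f \<Longrightarrow> mixed_partial k l (\<lambda>z. a * f z) = (\<lambda>z. a * mixed_partial k l f z)"
  by (simp add: mixed_partial_def v.funpow_D_cmult x.funpow_D_cmult v.smooth_D_funpow)

text \<open>Leibniz' rule is applied in \<open>v\<close> and then, to each resulting summand, in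
  \<open>x\<close>; this produces the sums in the opposite order, and they are swapped at the
  end.\<close>

lemma mixed_partial_mult:
  assumes "smooth f" "smooth g"
  shows "mixed_partial k l (\<lambda>z. f z * g z) = (\<lambda>z. \<Sum>i\<le>k. \<Sum>j\<le>l.
    real (k choose i) * real (l choose j) * (mixed_partial i j f z * mixed_partial (k - i) (l - j) g z))"
proof -
  note smooth_v = v.smooth_D_funpow[OF assms(1)] v.smooth_D_funpow[OF assms(2)]
  have "mixed_partial k l (\<lambda>z. f z * g z) = (\<lambda>z. \<Sum>j\<le>l. \<Sum>i\<le>k.
    real (k choose i) * real (l choose j) * (mixed_partial i j f z * mixed_partial (k - i) (l - j) g z))"
    unfolding mixed_partial_def v.funpow_D_mult[OF assms]
    by (subst x.funpow_D_sum)
       (auto intro!: smooth_mult smooth_const smooth_v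
         simp: x.funpow_D_cmult x.funpow_D_mult smooth_v smooth_mult sum_distrib_left mult_ac)
  then show ?thesis
    by (simp add: sum.swap[of _ "{..l}"])
qed

text \<open>The \<open>v\<close>-derivatives are taken termwise with the bounds for
  \<open>k = 0\<close>; then, for fixed \<open>l\<close>, the \<open>x\<close>-derivatives with the
  bounds \<open>M k l\<close>.\<close>

lemma mixed_partial_suminf:
  assumes "\<And>n. smooth (f n)" and "\<And>k l. summable (M k l)"
    and "\<And>k l n z. \<bar>mixed_partial k l (f n) z\<bar> \<le> M k l n"
  shows "mixed_partial k l (\<lambda>z. \<Sum>n. f n z) = (\<lambda>z. \<Sum>n. mixed_partial k l (f n) z)"
proof -
  have "(partial_v ^^ l) (\<lambda>z. \<Sum>n. f n z) = (\<lambda>z. \<Sum>n. (partial_v ^^ l) (f n) z)"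
    using assms(1,2) assms(3)[of 0, unfolded mixed_partial_def, simplified]
    by (intro v.funpow_D_suminf[where M = "M 0"]) auto
  then show ?thesis
    using assms(3) unfolding mixed_partial_def
    by (auto intro!: x.funpow_D_suminf[where M = "\<lambda>k. M k l"] v.smooth_D_funpow assms(1,2))
qed

section \<open>Rearranging double series in \<open>ennreal\<close>\<close>

text \<open>Tonelli's theorem, with one of the series read as an integral for counting
  measure.\<close>

lemma suminf_swap_ennreal:
  fixes f :: "nat \<Rightarrow> nat \<Rightarrow> ennreal"
  shows "(\<Sum>i. \<Sum>j. f i j) = (\<Sum>j. \<Sum>i. f i j)"
  unfolding nn_integral_count_space_nat[symmetric, of "\<lambda>j. \<Sum>i. f i j"]
  by (subst nn_integral_suminf) (auto simp: nn_integral_count_space_nat)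

text \<open>The finite inner sum is extended by zeros to a series; after exchanging the series, the
  inner one starts at \<open>k = i\<close> and is shifted by \<open>i\<close>.\<close>

lemma suminf_antidiagonal_ennreal:
  fixes h :: "nat \<Rightarrow> nat \<Rightarrow> ennreal"
  shows "(\<Sum>k. \<Sum>i\<le>k. h i (k - i)) = (\<Sum>i. \<Sum>j. h i j)"
proof -
  have "(\<Sum>i\<le>k. h i (k - i)) = (\<Sum>i. if i \<le> k then h i (k - i) else 0)" for k
    by (subst suminf_finite[of "{..k}"]) auto
  then have "(\<Sum>k. \<Sum>i\<le>k. h i (k - i)) = (\<Sum>i. \<Sum>k. if i \<le> k then h i (k - i) else 0)"
    by (simp only:) (rule suminf_swap_ennreal)
  moreover have "(\<Sum>k. if i \<le> k then h i (k - i) else 0) = (\<Sum>j. h i j)" for i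
    using suminf_offset[of "\<lambda>k. if i \<le> k then h i (k - i) else 0" i] by simp
  ultimately show ?thesis
    by simp
qed

text \<open>A Cauchy product in each index: the antidiagonal identity is used first for
  \<open>l\<close> with \<open>k\<close> and \<open>i\<close> fixed, then for
  \<open>k\<close>.\<close>

lemma suminf_double_convolution_ennreal:
  fixes F G :: "nat \<Rightarrow> nat \<Rightarrow> ennreal"
  shows "(\<Sum>k. \<Sum>l. \<Sum>i\<le>k. \<Sum>j\<le>l. F i j * G (k - i) (l - j)) = (\<Sum>k. \<Sum>l. F k l) * (\<Sum>k. \<Sum>l. G k l)"
proof -
  have "(\<Sum>l. \<Sum>i\<le>k. \<Sum>j\<le>l. F i j * G (k - i) (l - j)) =
      (\<Sum>i\<le>k. (\<Sum>j. F i j) * (\<Sum>j. G (k - i) j))" for k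
    by (subst suminf_sum) (simp_all add: suminf_antidiagonal_ennreal[of "\<lambda>j j'. F i j * G (k - i) j'" for i])
  then show ?thesis
    by (simp add: suminf_antidiagonal_ennreal[of "\<lambda>i i'. (\<Sum>j. F i j) * (\<Sum>j. G i' j)"])
qed

section \<open>Taylor weights and their submultiplicativity\<close>

lemma abs_le_sup_norm: "ennreal \<bar>f z\<bar> \<le> sup_norm f"
  unfolding sup_norm_def by (rule SUP_upper) simp

lemma sup_norm_cmult: "sup_norm (\<lambda>z. a * f z) = ennreal \<bar>a\<bar> * sup_norm f"
  by (simp add: sup_norm_def SUP_mult_left_ennreal abs_mult ennreal_mult)

definition lam_term :: "real \<Rightarrow> nat \<Rightarrow> nat \<Rightarrow> (real \<times> real \<Rightarrow> real) \<Rightarrow> ennreal" where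
  "lam_term lam k l f = ennreal (lam ^ (k + l) / (fact k * fact l)) * sup_norm (mixed_partial k l f)"

lemma lam_term_cmult:
  "smooth f \<Longrightarrow> lam_term lam k l (\<lambda>z. a * f z) = ennreal \<bar>a\<bar> * lam_term lam k l f"
  by (simp add: lam_term_def mixed_partial_cmult sup_norm_cmult mult_ac)

text \<open>A constant factor moves inside a supremum in \<open>ennreal\<close>, so estimates of a
  weight reduce to real estimates at single points.\<close>

lemma lam_term_leI:
  assumes "0 < lam"
    and "\<And>z. ennreal (lam ^ (k + l) / (fact k * fact l) * \<bar>mixed_partial k l f z\<bar>) \<le> B"
  shows "lam_term lam k l f \<le> B"
  unfolding lam_term_def sup_norm_def SUP_mult_left_ennreal
  using assms by (intro SUP_least) (simp add: ennreal_mult[symmetric])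

lemma lam_term_ge:
  assumes "0 < lam"
  shows "ennreal (lam ^ (k + l) / (fact k * fact l) * \<bar>mixed_partial k l f z\<bar>) \<le> lam_term lam k l f"
  unfolding lam_term_def using assms
  by (subst ennreal_mult) (auto intro: mult_left_mono abs_le_sup_norm)

lemma lam_term_mult:
  assumes "0 < lam" "smooth f" "smooth g"
  shows "lam_term lam k l (\<lambda>z. f z * g z) \<le>
    (\<Sum>i\<le>k. \<Sum>j\<le>l. lam_term lam i j f * lam_term lam (k - i) (l - j) g)"
proof (rule lam_term_leI[OF assms(1)])
  fix z
  let ?w = "\<lambda>k l. lam ^ (k + l) / (fact k * fact l)"
  define t where "t k l f = ?w k l * \<bar>mixed_partial k l f z\<bar>" for k l f
  have t_nonneg: "0 \<le> t k l f" for k l f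
    using assms(1) by (simp add: t_def)
  \<comment> \<open>The binomials turn \<open>1 / (k! l!)\<close> into the factorials of both
    factors, and the power of \<open>lam\<close> splits along
    \<open>k + l = (i + j) + ((k - i) + (l - j))\<close>.\<close>
  have weight: "?w k l * (real (k choose i) * real (l choose j)) = ?w i j * ?w (k - i) (l - j)"
    if "i \<le> k" "j \<le> l" for i j
  proof -
    have "k + l = (i + j) + ((k - i) + (l - j))"
      using that by simp
    then have "lam ^ (k + l) = lam ^ (i + j) * lam ^ ((k - i) + (l - j))"
      by (metis power_add)
    then show ?thesis
      using that by (simp add: binomial_fact field_simps)
  qed
  have "t k l (\<lambda>z. f z * g z) \<le> ?w k l * (\<Sum>i\<le>k. \<Sum>j\<le>l.
    \<bar>real (k choose i) * real (l choose j) * (mixed_partial i j f z * mixed_partial (k - i) (l - j) g z)\<bar>)"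
    unfolding t_def mixed_partial_mult[OF assms(2,3)] using assms(1)
    by (intro mult_left_mono order_trans[OF sum_abs] sum_mono) auto
  also have "\<dots> = (\<Sum>i\<le>k. \<Sum>j\<le>l. ?w k l * (real (k choose i) * real (l choose j)) *
      (\<bar>mixed_partial i j f z\<bar> * \<bar>mixed_partial (k - i) (l - j) g z\<bar>))"
    by (simp add: sum_distrib_left abs_mult mult_ac)
  also have "\<dots> = (\<Sum>i\<le>k. \<Sum>j\<le>l. t i j f * t (k - i) (l - j) g)"
    by (intro sum.cong refl) (subst weight, auto simp: t_def)
  finally have "ennreal (t k l (\<lambda>z. f z * g z)) \<le> ennreal (\<Sum>i\<le>k. \<Sum>j\<le>l. t i j f * t (k - i) (l - j) g)"
    by (rule ennreal_leI)
  also have "\<dots> = (\<Sum>i\<le>k. \<Sum>j\<le>l. ennreal (t i j f) * ennreal (t (k - i) (l - j) g))"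
    by (simp add: sum_nonneg t_nonneg ennreal_mult[symmetric])
  also have "\<dots> \<le> (\<Sum>i\<le>k. \<Sum>j\<le>l. lam_term lam i j f * lam_term lam (k - i) (l - j) g)"
    unfolding t_def by (intro sum_mono mult_mono lam_term_ge assms(1)) auto
  finally show "ennreal (?w k l * \<bar>mixed_partial k l (\<lambda>z. f z * g z) z\<bar>) \<le> \<dots>"
    unfolding t_def .
qed

text \<open>This is \<open>lam\<close> times the first seminorm, without the truncated exponent \<open>k + l - 1\<close>.\<close>

definition lam_moment :: "real \<Rightarrow> (real \<times> real \<Rightarrow> real) \<Rightarrow> ennreal" where
  "lam_moment lam f = (\<Sum>k. \<Sum>l. of_nat (k + l) * lam_term lam k l f)"

lemma lam_norm_eq: "lam_norm lam f = (\<Sum>k. \<Sum>l. lam_term lam k l f)"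
  by (simp add: lam_norm_def lam_term_def)

text \<open>The extra \<open>lam\<close> raises the exponent \<open>k + l - 1\<close> to
  \<open>k + l\<close>, and the quotient of factorials is \<open>k + l\<close>. At
  \<open>k = l = 0\<close>, where the subtraction truncates, both sides vanish.\<close>

lemma lam_moment_eq:
  assumes "0 < lam"
  shows "lam_moment lam f = ennreal lam * lam_seminorm lam 1 f"
proof -
  have "of_nat (k + l) * lam_term lam k l f = ennreal lam * (if 1 \<le> k + l
        then ennreal (fact (k + l) / fact (k + l - 1) * (lam ^ (k + l - 1) / (fact k * fact l)))
               * sup_norm (mixed_partial k l f)
        else 0)" for k l
  proof (cases "k + l")
    case (Suc n)
    have "of_nat (k + l) * ennreal (lam ^ (k + l) / (fact k * fact l)) =
        ennreal lam * ennreal (fact (k + l) / fact (k + l - 1) * (lam ^ (k + l - 1) / (fact k * fact l)))"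
      unfolding Suc ennreal_of_nat_eq_real_of_nat using assms
      by (subst (1 2) ennreal_mult[symmetric]) (auto simp: field_simps simp del: of_nat_Suc)
    then show ?thesis
      using Suc by (simp add: lam_term_def mult.assoc[symmetric])
  qed simp
  then show ?thesis
    by (simp only: lam_moment_def lam_seminorm_def ennreal_suminf_cmult)
qed

section \<open>Norm and moment of products, constants and powers\<close>

lemma lam_norm_mult:
  assumes "0 < lam" "smooth f" "smooth g"
  shows "lam_norm lam (\<lambda>z. f z * g z) \<le> lam_norm lam f * lam_norm lam g"
  unfolding lam_norm_eq suminf_double_convolution_ennreal[symmetric]
  by (intro suminf_le lam_term_mult assms) auto

lemma lam_moment_mult:
  assumes "0 < lam" "smooth f" "smooth g"
  shows "lam_moment lam (\<lambda>z. f z * g z) \<le>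
    lam_moment lam f * lam_norm lam g + lam_norm lam f * lam_moment lam g"
proof -
  let ?a = "\<lambda>k l. lam_term lam k l f" and ?b = "\<lambda>k l. lam_term lam k l g"
  let ?a' = "\<lambda>k l. of_nat (k + l) * ?a k l" and ?b' = "\<lambda>k l. of_nat (k + l) * ?b k l"
  have "of_nat (k + l) * lam_term lam k l (\<lambda>z. f z * g z) \<le>
      (\<Sum>i\<le>k. \<Sum>j\<le>l. ?a' i j * ?b (k - i) (l - j)) + (\<Sum>i\<le>k. \<Sum>j\<le>l. ?a i j * ?b' (k - i) (l - j))"
    for k l
  proof -
    have "of_nat (k + l) * lam_term lam k l (\<lambda>z. f z * g z) \<le>
        of_nat (k + l) * (\<Sum>i\<le>k. \<Sum>j\<le>l. ?a i j * ?b (k - i) (l - j))"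
      by (intro mult_left_mono lam_term_mult assms) auto
    \<comment> \<open>For \<open>i \<le> k\<close> and \<open>j \<le> l\<close> the natural
      subtractions are exact, so the factor \<open>k + l\<close> splits into one degree for each
      function.\<close>
    also have "\<dots> = (\<Sum>i\<le>k. \<Sum>j\<le>l. of_nat ((i + j) + ((k - i) + (l - j))) * (?a i j * ?b (k - i) (l - j)))"
      by (simp add: sum_distrib_left)
    also have "\<dots> = (\<Sum>i\<le>k. \<Sum>j\<le>l. ?a' i j * ?b (k - i) (l - j)) + (\<Sum>i\<le>k. \<Sum>j\<le>l. ?a i j * ?b' (k - i) (l - j))"
      unfolding sum.distrib[symmetric] of_nat_add[of "i + j" for i j]
      by (intro sum.cong refl) (simp only: distrib_left distrib_right mult_ac)
    finally show ?thesis .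
  qed
  then have "lam_moment lam (\<lambda>z. f z * g z) \<le> (\<Sum>k. \<Sum>l.
      (\<Sum>i\<le>k. \<Sum>j\<le>l. ?a' i j * ?b (k - i) (l - j)) + (\<Sum>i\<le>k. \<Sum>j\<le>l. ?a i j * ?b' (k - i) (l - j)))"
    unfolding lam_moment_def by (intro suminf_le) auto
  also have "\<dots> = lam_moment lam f * lam_norm lam g + lam_norm lam f * lam_moment lam g"
    unfolding lam_norm_eq lam_moment_def suminf_double_convolution_ennreal[symmetric]
    by (simp add: suminf_add[symmetric])
  finally show ?thesis .
qed

lemma lam_term_const: "lam_term lam k l (\<lambda>z. a) = (if k = 0 \<and> l = 0 then ennreal \<bar>a\<bar> else 0)"
  by (simp add: lam_term_def mixed_partial_const sup_norm_def)

lemma lam_norm_const: "lam_norm lam (\<lambda>z. a) = ennreal \<bar>a\<bar>"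
proof -
  have "(\<Sum>l. lam_term lam k l (\<lambda>z. a)) = (if k = 0 then ennreal \<bar>a\<bar> else 0)" for k
    by (subst suminf_finite[of "{0}"]) (auto simp: lam_term_const)
  then show ?thesis
    unfolding lam_norm_eq by (subst suminf_finite[of "{0}"]) auto
qed

lemma lam_moment_const: "lam_moment lam (\<lambda>z. a) = 0"
proof -
  have "of_nat (k + l) * lam_term lam k l (\<lambda>z. a) = 0" for k l
    by (simp add: lam_term_const)
  then show ?thesis
    by (simp only: lam_moment_def suminf_zero)
qed

lemma lam_norm_cmult: "smooth f \<Longrightarrow> lam_norm lam (\<lambda>z. a * f z) = ennreal \<bar>a\<bar> * lam_norm lam f"
  by (simp add: lam_norm_eq lam_term_cmult)

lemma lam_moment_cmult:
  "smooth f \<Longrightarrow> lam_moment lam (\<lambda>z. a * f z) = ennreal \<bar>a\<bar> * lam_moment lam f"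
  by (simp add: lam_moment_def lam_term_cmult mult.left_commute[of _ "ennreal \<bar>a\<bar>"])

lemma lam_norm_power:
  assumes "0 < lam" "smooth f"
  shows "lam_norm lam (\<lambda>z. f z ^ n) \<le> lam_norm lam f ^ n"
proof (induction n)
  case (Suc n)
  have "lam_norm lam (\<lambda>z. f z ^ Suc n) \<le> lam_norm lam f * lam_norm lam (\<lambda>z. f z ^ n)"
    unfolding power_Suc by (intro lam_norm_mult smooth_power assms)
  also have "\<dots> \<le> lam_norm lam f * lam_norm lam f ^ n"
    by (intro mult_left_mono Suc) simp
  finally show ?case
    by simp
qed (simp add: lam_norm_const)

text \<open>Induction with the product rule. Stating it for \<open>Suc n\<close> avoids the exponent
  \<open>n - 1\<close>; the constant power is treated by \<open>lam_moment_const\<close>.\<close>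

lemma lam_moment_power:
  assumes "0 < lam" "smooth f"
  shows "lam_moment lam (\<lambda>z. f z ^ Suc n) \<le> of_nat (Suc n) * lam_norm lam f ^ n * lam_moment lam f"
proof (induction n)
  case (Suc n)
  let ?N = "lam_norm lam f" and ?M = "lam_moment lam f"
  have "lam_moment lam (\<lambda>z. f z ^ Suc (Suc n)) \<le>
      ?M * lam_norm lam (\<lambda>z. f z ^ Suc n) + ?N * lam_moment lam (\<lambda>z. f z ^ Suc n)"
    unfolding power_Suc[of _ "Suc n"] by (intro lam_moment_mult smooth_power assms)
  also have "\<dots> \<le> ?M * ?N ^ Suc n + ?N * (of_nat (Suc n) * ?N ^ n * ?M)"
    by (intro add_mono mult_left_mono Suc lam_norm_power assms) auto
  also have "\<dots> = of_nat (Suc (Suc n)) * ?N ^ Suc n * ?M"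
    by (simp add: algebra_simps)
  finally show ?case .
qed simp

section \<open>Norm and moment of a series of functions\<close>

lemma lam_term_le_lam_norm: "lam_term lam k l f \<le> lam_norm lam f"
proof -
  have "lam_term lam k l f \<le> (\<Sum>l. lam_term lam k l f)"
    using sum_le_suminf[of "\<lambda>l. lam_term lam k l f" "{l}"] by simp
  also have "\<dots> \<le> lam_norm lam f"
    unfolding lam_norm_eq using sum_le_suminf[of "\<lambda>k. \<Sum>l. lam_term lam k l f" "{k}"] by simp
  finally show ?thesis .
qed

text \<open>The term with \<open>k = l = 0\<close> is the supremum norm. This keeps the values of
  \<open>u\<close> inside the interval of convergence.\<close>

lemma abs_le_lam_norm: "ennreal \<bar>f z\<bar> \<le> lam_norm lam f"
  using order_trans[OF abs_le_sup_norm, of f "lam_norm lam f" z] lam_term_le_lam_norm[of lam 0 0 f]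
  by (simp add: lam_term_def mixed_partial_def)

text \<open>Summable norms dominate the derivatives of each order by a summable sequence, uniformly
  in \<open>z\<close>. Differentiation is therefore termwise, and the triangle inequality
  finishes.\<close>

lemma lam_term_suminf:
  assumes "0 < lam" "\<And>n. smooth (f n)" "(\<Sum>n. lam_norm lam (f n)) < \<infinity>"
  shows "lam_term lam k l (\<lambda>z. \<Sum>n. f n z) \<le> (\<Sum>n. lam_term lam k l (f n))"
proof -
  let ?w = "\<lambda>k l. lam ^ (k + l) / (fact k * fact l)"
  \<comment> \<open>Each term is bounded by a finite series, so it is finite and
    \<open>enn2real\<close> loses nothing.\<close>
  define t where "t k l n = enn2real (lam_term lam k l (f n))" for k l n
  have finite: "(\<Sum>n. lam_term lam k l (f n)) < \<infinity>" for k l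
    using assms(3) by (rule le_less_trans[rotated]) (auto intro: suminf_le lam_term_le_lam_norm)
  have "lam_term lam k l (f n) \<le> (\<Sum>n. lam_term lam k l (f n))" for k l n
    using sum_le_suminf[of "\<lambda>n. lam_term lam k l (f n)" "{n}"] by simp
  then have t: "ennreal (t k l n) = lam_term lam k l (f n)" for k l n
    unfolding t_def using finite[of k l] by (intro ennreal_enn2real) (auto intro: le_less_trans)
  have summable_t: "summable (t k l)" for k l
    using finite[of k l] by (intro summable_suminf_not_top) (simp_all add: t, simp add: t_def)
  have w_pos: "0 < ?w k l" for k l
    using assms(1) by simp
  have bound: "?w k l * \<bar>mixed_partial k l (f n) z\<bar> \<le> t k l n" for k l n z
    using lam_term_ge[OF assms(1), of k l "f n" z] unfolding t[symmetric]
    by (subst (asm) ennreal_le_iff) (auto simp: t_def)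
  \<comment> \<open>Dividing out the positive weight gives the dominating sequence required by
    \<open>mixed_partial_suminf\<close>.\<close>
  have summable_M: "summable (\<lambda>n. t k l n / ?w k l)" for k l
    by (intro summable_divide summable_t)
  have bound': "\<bar>mixed_partial k l (f n) z\<bar> \<le> t k l n / ?w k l" for k l n z
    using bound[of k l n z] by (subst pos_le_divide_eq[OF w_pos]) (simp add: mult.commute)
  show ?thesis
  proof (rule lam_term_leI[OF assms(1)])
    fix z
    have summable: "summable (\<lambda>n. \<bar>mixed_partial k l (f n) z\<bar>)"
      by (rule summable_comparison_test'[OF summable_M[of k l], of 0]) (simp only: real_norm_def abs_abs bound')
    have "?w k l * \<bar>mixed_partial k l (\<lambda>z. \<Sum>n. f n z) z\<bar> = ?w k l * \<bar>\<Sum>n. mixed_partial k l (f n) z\<bar>"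
      by (subst mixed_partial_suminf[OF assms(2) summable_M bound']) (rule refl)
    also have "\<dots> \<le> ?w k l * (\<Sum>n. \<bar>mixed_partial k l (f n) z\<bar>)"
      using w_pos[of k l] by (intro mult_left_mono summable_rabs summable) simp
    also have "\<dots> = (\<Sum>n. ?w k l * \<bar>mixed_partial k l (f n) z\<bar>)"
      by (rule suminf_mult[OF summable, symmetric])
    also have "\<dots> \<le> (\<Sum>n. t k l n)"
      by (intro suminf_le bound summable_mult summable summable_t)
    finally have "ennreal (?w k l * \<bar>mixed_partial k l (\<lambda>z. \<Sum>n. f n z) z\<bar>) \<le> ennreal (\<Sum>n. t k l n)"
      by (rule ennreal_leI)
    also have "\<dots> = (\<Sum>n. lam_term lam k l (f n))"
      unfolding t[symmetric] by (rule suminf_ennreal2[symmetric]) (simp_all add: summable_t, simp add: t_def)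
    finally show "ennreal (?w k l * \<bar>mixed_partial k l (\<lambda>z. \<Sum>n. f n z) z\<bar>) \<le> \<dots>" .
  qed
qed

lemma suminf_rotate_le_ennreal:
  fixes a :: "nat \<Rightarrow> nat \<Rightarrow> ennreal"
  assumes "\<And>k l. a k l \<le> (\<Sum>n. b n k l)"
  shows "(\<Sum>k. \<Sum>l. a k l) \<le> (\<Sum>n. \<Sum>k. \<Sum>l. b n k l)"
proof -
  have "(\<Sum>k. \<Sum>l. a k l) \<le> (\<Sum>k. \<Sum>l. \<Sum>n. b n k l)"
    by (intro suminf_le assms) auto
  also have "\<dots> = (\<Sum>k. \<Sum>n. \<Sum>l. b n k l)"
    by (subst suminf_swap_ennreal) (rule refl)
  also have "\<dots> = (\<Sum>n. \<Sum>k. \<Sum>l. b n k l)"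
    by (rule suminf_swap_ennreal)
  finally show ?thesis .
qed

lemma lam_norm_suminf:
  assumes "0 < lam" "\<And>n. smooth (f n)" "(\<Sum>n. lam_norm lam (f n)) < \<infinity>"
  shows "lam_norm lam (\<lambda>z. \<Sum>n. f n z) \<le> (\<Sum>n. lam_norm lam (f n))"
  unfolding lam_norm_eq
  by (rule suminf_rotate_le_ennreal, rule lam_term_suminf[OF assms])

text \<open>Finite norms justify termwise differentiation of the series; the moments themselves may
  be infinite.\<close>

lemma lam_moment_suminf:
  assumes "0 < lam" "\<And>n. smooth (f n)" "(\<Sum>n. lam_norm lam (f n)) < \<infinity>"
  shows "lam_moment lam (\<lambda>z. \<Sum>n. f n z) \<le> (\<Sum>n. lam_moment lam (f n))"
  unfolding lam_moment_def
  by (rule suminf_rotate_le_ennreal)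
     (simp only: ennreal_suminf_cmult, intro mult_left_mono lam_term_suminf assms, simp)

section \<open>Substituting a function into a power series\<close>

text \<open>Convergence at some \<open>s\<close> with \<open>norm r < s < R\<close> forces absolute
  convergence at \<open>r\<close>.\<close>

lemma summable_abs_power_series:
  fixes c :: "nat \<Rightarrow> real"
  assumes "\<And>z. norm z < R \<Longrightarrow> summable (\<lambda>n. c n * z ^ n)" and "norm r < R"
  shows "summable (\<lambda>n. \<bar>c n\<bar> * r ^ n)"
proof -
  obtain s where "norm r < s" "s < R"
    using dense[OF assms(2)] by blast
  then have "summable (\<lambda>n. norm (c n * r ^ n))"
    by (intro powser_insidea[OF assms(1)[of s]]) auto
  then show ?thesis
    by (intro summable_norm_cancel[where f = "\<lambda>n. \<bar>c n\<bar> * r ^ n"]) (simp add: abs_mult)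
qed

text \<open>The coefficients stay generic because the locale is used twice: for the series itself
  and for its tails.\<close>

locale power_series_of_function =
  fixes R lam r :: real and c :: "nat \<Rightarrow> real" and u :: "real \<times> real \<Rightarrow> real"
  assumes summable: "norm z < R \<Longrightarrow> summable (\<lambda>n. c n * z ^ n)"
    and lam_pos: "0 < lam" and smooth_u: "smooth u"
    and lam_norm_u: "lam_norm lam u = ennreal r" and r_nonneg: "0 \<le> r" and r_less: "r < R"
begin

lemma abs_u_less: "\<bar>u z\<bar> < R"
  using abs_le_lam_norm[of u z lam] r_less r_nonneg unfolding lam_norm_u by simp

lemma summable_majorant: "summable (\<lambda>n. \<bar>c n\<bar> * r ^ n)"
  using summable_abs_power_series[of R c r] summable r_nonneg r_less by simp

text \<open>These are the terms of the formally differentiated series with coefficients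
  \<open>\<bar>c n\<bar>\<close>, which converges on the same interval.\<close>

lemma summable_majorant_deriv: "summable (\<lambda>n. real (Suc n) * \<bar>c (Suc n)\<bar> * r ^ n)"
  using termdiff_converges[of r R "\<lambda>n. \<bar>c n\<bar>"] summable_abs_power_series[of R c] summable
    r_nonneg r_less by (simp add: diffs_def)

lemma smooth_term: "smooth (\<lambda>z. c n * u z ^ n)"
  by (intro smooth_mult smooth_const smooth_power smooth_u)

lemma lam_norm_term: "lam_norm lam (\<lambda>z. c n * u z ^ n) \<le> ennreal (\<bar>c n\<bar> * r ^ n)"
  using lam_norm_power[OF lam_pos smooth_u, of n] r_nonneg unfolding lam_norm_u
  by (auto simp: lam_norm_cmult smooth_power smooth_u ennreal_mult ennreal_power intro: mult_left_mono)

lemma suminf_lam_norm_term: "(\<Sum>n. lam_norm lam (\<lambda>z. c n * u z ^ n)) \<le> ennreal (majorant c r)"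
proof -
  have "(\<Sum>n. lam_norm lam (\<lambda>z. c n * u z ^ n)) \<le> (\<Sum>n. ennreal (\<bar>c n\<bar> * r ^ n))"
    by (intro suminf_le lam_norm_term) auto
  also have "\<dots> = ennreal (majorant c r)"
    unfolding majorant_def using summable_majorant r_nonneg by (intro suminf_ennreal2) auto
  finally show ?thesis .
qed

lemma suminf_lam_norm_term_finite: "(\<Sum>n. lam_norm lam (\<lambda>z. c n * u z ^ n)) < \<infinity>"
  using suminf_lam_norm_term by (rule le_less_trans) simp

lemma smooth_series: "smooth (\<lambda>z. \<Sum>n. c n * u z ^ n)"
  by (rule smooth_power_series_compose[OF summable abs_u_less smooth_u])

lemma lam_norm_series: "lam_norm lam (\<lambda>z. \<Sum>n. c n * u z ^ n) \<le> ennreal (majorant c r)"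
  using lam_norm_suminf[OF lam_pos smooth_term suminf_lam_norm_term_finite] suminf_lam_norm_term
  by (rule order_trans)

lemma lam_moment_series:
  "lam_moment lam (\<lambda>z. \<Sum>n. c n * u z ^ n) \<le> ennreal (majorant_deriv c r) * lam_moment lam u"
proof -
  let ?M = "\<lambda>n. lam_moment lam (\<lambda>z. c n * u z ^ n)"
  have "lam_moment lam (\<lambda>z. \<Sum>n. c n * u z ^ n) \<le> (\<Sum>n. ?M n)"
    by (rule lam_moment_suminf[OF lam_pos smooth_term suminf_lam_norm_term_finite])
  \<comment> \<open>The term of index 0 is constant and has moment 0; dropping it matches the index
    shift in \<open>majorant_deriv\<close>.\<close>
  also have "\<dots> = (\<Sum>n. ?M (Suc n))"
    using suminf_offset[of ?M 1] by (simp add: lam_moment_const)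
  also have "\<dots> \<le> (\<Sum>n. ennreal (real (Suc n) * \<bar>c (Suc n)\<bar> * r ^ n) * lam_moment lam u)"
  proof (intro suminf_le)
    fix n
    have "?M (Suc n) \<le> ennreal \<bar>c (Suc n)\<bar> * (of_nat (Suc n) * ennreal r ^ n * lam_moment lam u)"
      unfolding lam_moment_cmult[OF smooth_power[OF smooth_u]] lam_norm_u[symmetric]
      by (intro mult_left_mono lam_moment_power lam_pos smooth_u) simp
    also have "\<dots> = ennreal (real (Suc n) * \<bar>c (Suc n)\<bar> * r ^ n) * lam_moment lam u"
      using r_nonneg by (simp only: ennreal_of_nat_eq_real_of_nat ennreal_power)
        (simp add: ennreal_mult mult_ac del: of_nat_Suc)
    finally show "?M (Suc n) \<le> \<dots>" .
  qed auto
  also have "\<dots> = ennreal (majorant_deriv c r) * lam_moment lam u"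
    unfolding majorant_deriv_def ennreal_suminf_multc using summable_majorant_deriv r_nonneg
    by (subst suminf_ennreal2) auto
  finally show ?thesis .
qed

end

section \<open>Norm convergence and the two majorant estimates\<close>

theorem lemma3p6:
  fixes R \<Lambda> lam :: real and \<Phi> :: "real \<Rightarrow> real" and c :: "nat \<Rightarrow> real"
    and u :: "real \<times> real \<Rightarrow> real"
  assumes "R > 0"
    and "\<And>z. \<bar>z\<bar> < R \<Longrightarrow> (\<lambda>n. c n * z ^ n) sums \<Phi> z"
    and "analytic_radius \<Lambda> u"
    and "0 < lam" and "lam < \<Lambda>"
    and "lam_norm lam u < ennreal R"
  shows "lam_sums lam (\<lambda>n z. c n * u z ^ n) (\<lambda>z. \<Phi> (u z))
    \<and> lam_norm lam (\<lambda>z. \<Phi> (u z)) \<le> ennreal (majorant c (enn2real (lam_norm lam u)))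
    \<and> lam_seminorm lam 1 (\<lambda>z. \<Phi> (u z))
        \<le> ennreal (majorant_deriv c (enn2real (lam_norm lam u))) * lam_seminorm lam 1 u"
proof -
  define r where "r = enn2real (lam_norm lam u)"
  \<comment> \<open>The norm lies below \<open>ennreal R\<close>, hence is finite and represented
    faithfully by the real \<open>r\<close>.\<close>
  have r: "lam_norm lam u = ennreal r" "0 \<le> r" "r < R"
    using assms(1,6) by (cases "lam_norm lam u"; auto simp: r_def ennreal_less_iff)+
  have "smooth u"
    using assms(3) by (simp add: analytic_radius_def)
  interpret power_series_of_function R lam r c u
    using assms(2,4) r \<open>smooth u\<close> by unfold_locales (auto intro: sums_summable)
  have \<Phi>: "(\<lambda>n. c n * u z ^ n) sums \<Phi> (u z)" for z
    by (rule assms(2)[OF abs_u_less])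
  then have \<Phi>_eq: "(\<lambda>z. \<Phi> (u z)) = (\<lambda>z. \<Sum>n. c n * u z ^ n)"
    by (simp add: sums_iff)
  have norm_le: "lam_norm lam (\<lambda>z. \<Phi> (u z)) \<le> ennreal (majorant c r)"
    unfolding \<Phi>_eq by (rule lam_norm_series)
  \<comment> \<open>The moment estimate is the seminorm estimate multiplied by \<open>lam\<close>, a
    positive finite factor that can be cancelled.\<close>
  have "ennreal lam * lam_seminorm lam 1 (\<lambda>z. \<Phi> (u z))
      \<le> ennreal lam * (ennreal (majorant_deriv c r) * lam_seminorm lam 1 u)"
    using lam_moment_series unfolding \<Phi>_eq lam_moment_eq[OF assms(4)] by (simp add: mult_ac)
  then have seminorm_le: "lam_seminorm lam 1 (\<lambda>z. \<Phi> (u z))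
      \<le> ennreal (majorant_deriv c r) * lam_seminorm lam 1 u"
    using assms(4) by (subst (asm) ennreal_mult_le_mult_iff) auto
  have "(\<lambda>N. lam_norm lam (\<lambda>z. (\<Sum>n<N. c n * u z ^ n) - \<Phi> (u z))) \<longlonglongrightarrow> 0"
  proof (rule tendsto_sandwich[where f = "\<lambda>_. 0"])
    show "\<forall>\<^sub>F N in sequentially. lam_norm lam (\<lambda>z. (\<Sum>n<N. c n * u z ^ n) - \<Phi> (u z))
        \<le> ennreal (majorant c r - (\<Sum>n<N. \<bar>c n\<bar> * r ^ n))"
    proof (intro always_eventually allI)
      fix N
      \<comment> \<open>These are the coefficients of partial sum minus full series: 0 below
        \<open>N\<close> and \<open>- c n\<close> from \<open>N\<close> on.\<close>
      define d where "d n = (if n < N then c n else 0) - c n" for n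
      have d_sums: "(\<lambda>n. d n * z ^ n) sums ((\<Sum>n<N. c n * z ^ n) - \<Phi> z)" if "\<bar>z\<bar> < R" for z
      proof -
        have "(\<lambda>n. if n \<in> {..<N} then c n * z ^ n else 0) sums (\<Sum>n<N. c n * z ^ n)"
          by (rule sums_If_finite_set) simp
        from sums_diff[OF this assms(2)[OF that]] show ?thesis
          by (rule sums_cong[THEN iffD1, rotated]) (simp add: d_def left_diff_distrib)
      qed
      interpret tail: power_series_of_function R lam r d u
        using d_sums assms(4) r \<open>smooth u\<close> by unfold_locales (auto intro: sums_summable)
      have "(\<lambda>z. (\<Sum>n<N. c n * u z ^ n) - \<Phi> (u z)) = (\<lambda>z. \<Sum>n. d n * u z ^ n)"
        using d_sums[OF abs_u_less] by (simp add: sums_iff)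
      \<comment> \<open>Here \<open>\<bar>d n\<bar>\<close> is \<open>\<bar>c n\<bar>\<close> from
        \<open>N\<close> on and 0 before, so the majorant of \<open>d\<close> is the tail of a
        convergent series and tends to 0.\<close>
      moreover have "majorant d r = majorant c r - (\<Sum>n<N. \<bar>c n\<bar> * r ^ n)"
      proof -
        have "(\<lambda>n. if n \<in> {..<N} then \<bar>c n\<bar> * r ^ n else 0) sums (\<Sum>n<N. \<bar>c n\<bar> * r ^ n)"
          by (rule sums_If_finite_set) simp
        from sums_diff[OF summable_sums[OF summable_majorant] this] show ?thesis
          unfolding majorant_def
          by (intro sums_unique[symmetric], elim sums_cong[THEN iffD1, rotated]) (simp add: d_def)
      qed
      ultimately show "lam_norm lam (\<lambda>z. (\<Sum>n<N. c n * u z ^ n) - \<Phi> (u z))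
          \<le> ennreal (majorant c r - (\<Sum>n<N. \<bar>c n\<bar> * r ^ n))"
        using tail.lam_norm_series by simp
    qed
    have "(\<lambda>N. ennreal (majorant c r - (\<Sum>n<N. \<bar>c n\<bar> * r ^ n))) \<longlonglongrightarrow> ennreal (majorant c r - majorant c r)"
      unfolding majorant_def
      by (intro tendsto_ennrealI tendsto_diff tendsto_const summable_LIMSEQ summable_majorant)
    then show "(\<lambda>N. ennreal (majorant c r - (\<Sum>n<N. \<bar>c n\<bar> * r ^ n))) \<longlonglongrightarrow> 0"
      by simp
  qed auto
  moreover have "(\<lambda>z. c n * u z ^ n) \<in> lam_space lam" for n
    unfolding lam_space_def using smooth_term le_less_trans[OF lam_norm_term] by auto
  moreover have "(\<lambda>z. \<Phi> (u z)) \<in> lam_space lam"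
    unfolding lam_space_def using smooth_series le_less_trans[OF norm_le] by (auto simp: \<Phi>_eq)
  ultimately show ?thesis
    using norm_le seminorm_le unfolding lam_sums_def r_def by blast
qed

end
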